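(* Let $G$ be a finite group of even order $2k$. Then there exists a subset $S$ of $G$ with exactly $k$ elements such that $S^2\neq G$.
   Context: $S^2=\{st: s,t\in S\}$ denotes the product set. *)

theory Defs
  imports "HOL-Algebra.Coset"
begin

end

theory Submission
  imports Defs "HOL-Algebra.Multiplicative_Group" "HOL-Algebra.Sylow"
begin

text \<open>
  An element \<open>g\<close> lies outside \<open>S\<^sup>2\<close> iff the map \<open>f s = s\<inverse> g\<close> sends \<open>S\<close> into its complement. Hence it
  suffices to 2-colour the graph of the permutation \<open>f\<close>, which is possible when no two iterates of
  a point of opposite parity coincide. Such a coincidence makes an odd power of \<open>g\<close> a square; this is
  excluded by taking \<open>g\<close> of maximal order among the elements whose order is a power of 2, and
  \<open>g \<noteq> 1\<close> because the group has even order.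
\<close>

text \<open>Colour \<open>x\<close> by the parity of \<open>m + n\<close>, where the
  \<open>m\<close>-th iterate of \<open>x\<close> meets the \<open>n\<close>-th iterate of a fixed
  representative of its component. The hypothesis makes this parity independent of the choice of
  \<open>m\<close> and \<open>n\<close>, and one application of \<open>f\<close> flips it.\<close>

lemma ex_alternating_set:
  assumes even: "\<And>x m n. x \<in> X \<Longrightarrow> (f ^^ m) x = (f ^^ n) x \<Longrightarrow> even (m + n)"
  shows "\<exists>S\<subseteq>X. \<forall>x\<in>X. f x \<in> X \<longrightarrow> (f x \<in> S \<longleftrightarrow> x \<notin> S)"
proof -
  \<comment> \<open>Connectedness in the graph of \<open>f\<close>. Since \<open>f\<close> need not
    be injective, two points are linked when their forward orbits meet.\<close>
  define E where "E x y \<longleftrightarrow> (\<exists>m n. (f ^^ m) x = (f ^^ n) y)" for x y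
  have E_sym: "E y x" if "E x y" for x y
    using that unfolding E_def by metis
  have E_trans: "E x z" if xy: "E x y" and yz: "E y z" for x y z
  proof -
    obtain m n p q where mn: "(f ^^ m) x = (f ^^ n) y" and pq: "(f ^^ p) y = (f ^^ q) z"
      using xy yz unfolding E_def by auto
    have "(f ^^ (p + m)) x = (f ^^ (p + n)) y"
      using mn by (simp add: funpow_add)
    also have "\<dots> = (f ^^ (n + q)) z"
      using pq by (simp add: funpow_add add.commute[of p n])
    finally show ?thesis unfolding E_def by blast
  qed
  define r where "r x = (SOME y. E x y)" for x
  have r: "E x (r x)" for x
    unfolding r_def by (rule someI[of _ x]) (auto simp: E_def)
  have "E x (f x)" for x
    unfolding E_def by (rule exI[of _ 1], rule exI[of _ 0]) simp
  \<comment> \<open>As \<open>x\<close> and \<open>f x\<close> have the same predicate, not just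
    related ones, \<open>SOME\<close> picks the same representative for both.\<close>
  then have "E x = E (f x)" for x
    by (intro ext) (metis E_sym E_trans)
  then have r_f: "r (f x) = r x" for x
    by (simp add: r_def)
  define S where "S = {x\<in>X. \<exists>m n. even (m + n) \<and> (f ^^ m) x = (f ^^ n) (r x)}"
  have "f x \<in> S \<longleftrightarrow> x \<notin> S" if x: "x \<in> X" "f x \<in> X" for x
  proof
    assume fx: "f x \<in> S"
    show "x \<notin> S"
    proof
      assume "x \<in> S"
      then obtain m n where mn: "even (m + n)" "(f ^^ m) x = (f ^^ n) (r x)"
        by (auto simp: S_def)
      obtain p q where pq: "even (p + q)" "(f ^^ Suc p) x = (f ^^ q) (r x)"
        using fx by (auto simp: S_def r_f funpow_Suc_right simp del: funpow.simps)
      \<comment> \<open>Both links from \<open>x\<close> to \<open>r x\<close> are extended until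
        they meet in one iterate of \<open>r x\<close>. This equates two iterates of
        \<open>x\<close> whose exponents have an odd sum.\<close>
      have "(f ^^ (q + m)) x = (f ^^ (q + n)) (r x)"
        using mn by (simp add: funpow_add)
      also have "\<dots> = (f ^^ (n + Suc p)) x"
        unfolding add.commute[of q n] funpow_add o_apply pq(2) ..
      finally have "even ((q + m) + (n + Suc p))"
        using even x(1) by blast
      with mn(1) pq(1) show False by simp presburger
    qed
  next
    assume nx: "x \<notin> S"
    obtain m n where mn: "(f ^^ m) x = (f ^^ n) (r x)"
      using r unfolding E_def by blast
    with nx x have "odd (m + n)" by (auto simp: S_def)
    moreover have "(f ^^ m) (f x) = (f ^^ Suc n) (r (f x))"
      using mn by (simp add: r_f) (metis funpow_swap1)
    ultimately show "f x \<in> S"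
      using x(2) unfolding S_def by (metis (mono_tags, lifting) add_Suc_right even_Suc mem_Collect_eq)
  qed
  moreover have "S \<subseteq> X" by (auto simp: S_def)
  ultimately show ?thesis by blast
qed

text \<open>The bijection \<open>f\<close> carries \<open>X - S\<close> onto \<open>S\<close>,
  because the preimage of a point of \<open>S\<close> lies outside \<open>S\<close>.\<close>

lemma card_alternating_set:
  assumes "finite X" and bij: "bij_betw f X X" and "S \<subseteq> X"
    and alt: "\<And>x. x \<in> X \<Longrightarrow> f x \<in> S \<longleftrightarrow> x \<notin> S"
  shows "card X = 2 * card S"
proof -
  have "f ` (X - S) = S"
  proof
    show "f ` (X - S) \<subseteq> S" using alt by auto
    show "S \<subseteq> f ` (X - S)"
    proof
      fix y assume "y \<in> S"
      then obtain x where "x \<in> X" "y = f x"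
        using bij_betw_imp_surj_on[OF bij] \<open>S \<subseteq> X\<close> by (metis imageE subsetD)
      with alt \<open>y \<in> S\<close> show "y \<in> f ` (X - S)" by auto
    qed
  qed
  moreover have "inj_on f (X - S)"
    using bij by (meson bij_betw_def inj_on_diff)
  ultimately have "card (X - S) = card S"
    by (metis card_image)
  then show ?thesis
    using assms card_Diff_subset[of S X] card_mono[of X S] finite_subset[of S X] by simp
qed

context group
begin

lemma ex_involution:
  assumes "finite (carrier G)" "even (order G)"
  obtains t where "t \<in> carrier G" "t \<noteq> \<one>" "t \<otimes> t = \<one>"
proof -
  \<comment> \<open>\<open>sylow_thm\<close> covers every prime power dividing the order, not only
    the largest; exponent 1 is Cauchy's theorem for the prime 2.\<close>
  have "\<exists>H. subgroup H G \<and> card H = 2 ^ 1"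
    using assms by (intro sylow_thm[where m = "order G div 2"]) auto
  then obtain H where H: "subgroup H G" "card H = 2" by auto
  have "\<one> \<in> H" using H(1) by (rule subgroup.one_closed)
  with H(2) obtain t where t: "H = {\<one>, t}" "t \<noteq> \<one>"
    by (auto simp: card_2_iff)
  have tc: "t \<in> carrier G" using H(1) t(1) subgroup.subset by blast
  have "t \<otimes> t \<in> H" using subgroup.m_closed[OF H(1), of t t] t(1) by simp
  moreover have "t \<otimes> t \<noteq> t" using tc t(2) by simp
  ultimately have "t \<otimes> t = \<one>" using t(1) by auto
  with tc t(2) that show ?thesis by blast
qed

lemma ex_odd_powers_nonsquare:
  assumes fin: "finite (carrier G)" and even: "even (order G)"
  obtains g where "g \<in> carrier G"
    "\<And>y d. y \<in> carrier G \<Longrightarrow> y \<otimes> y \<noteq> g [^] (2 * d + 1 :: int)"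
proof -
  define P where "P a \<longleftrightarrow> (\<exists>g\<in>carrier G. ord g = 2 ^ a)" for a :: nat
  obtain t where t: "t \<in> carrier G" "t \<noteq> \<one>" "t \<otimes> t = \<one>"
    using ex_involution[OF fin even] .
  have "t [^] (2::nat) = \<one>" using t by (simp add: numeral_2_eq_2)
  then have "ord t dvd 2" using t(1) pow_eq_id by blast
  moreover have "ord t \<noteq> 1" using t pow_ord_eq_1[of t] by (metis nat_pow_eone)
  ultimately have "ord t = 2"
    using prime_nat_iff two_is_prime_nat by blast
  then have P1: "P 1" unfolding P_def using t(1) by auto
  have bound: "a \<le> order G" if "P a" for a
  proof -
    have "a < 2 ^ a" by (rule less_exp)
    also have "2 ^ a \<le> order G" using that ord_le_group_order fin unfolding P_def by metis
    finally show ?thesis by simp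
  qed
  define a where "a = (GREATEST a. P a)"
  have Pa: "P a" unfolding a_def using P1 bound by (rule GreatestI_nat)
  have max: "b \<le> a" if "P b" for b
    unfolding a_def using that bound by (rule Greatest_le_nat)
  \<comment> \<open>The involution forces \<open>a\<close> to be positive, so \<open>a - 1\<close>
    is a genuine predecessor below.\<close>
  have a: "a = Suc (a - 1)" using max[OF P1] by simp
  obtain g where g: "g \<in> carrier G" "ord g = 2 ^ a" using Pa unfolding P_def by auto
  have "y \<otimes> y \<noteq> g [^] (2 * d + 1 :: int)" if y: "y \<in> carrier G" for y d
  proof
    assume sq: "y \<otimes> y = g [^] (2 * d + 1)"
    have pow2_eq: "y [^] (2::nat) = y \<otimes> y"
      using y by (simp add: numeral_2_eq_2)
    \<comment> \<open>Used twice: \<open>e = a\<close> shows that \<open>ord y\<close> is a power of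
      2, hence divides \<open>2 ^ a\<close> by maximality; then \<open>e = a - 1\<close> gives a
      trivial power of \<open>g\<close> whose exponent is not divisible by
      \<open>2 ^ a\<close>.\<close>
    have pow: "y [^] ((2::nat) ^ Suc e) = g [^] ((2 * d + 1) * 2 ^ e)" for e
    proof -
      have "y [^] ((2::nat) ^ Suc e) = (y \<otimes> y) [^] ((2::nat) ^ e)"
        using y nat_pow_pow[of y 2 "2 ^ e"] by (simp add: pow2_eq)
      also have "\<dots> = g [^] ((2 * d + 1) * 2 ^ e)"
        unfolding sq using g(1) by (simp add: int_pow_pow flip: int_pow_int)
      finally show ?thesis .
    qed
    have "g [^] ((2 * d + 1) * 2 ^ a) = \<one>"
      using g by (simp add: int_pow_eq_id)
    then have "ord y dvd 2 ^ Suc a"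
      using pow[of a] y by (simp add: pow_eq_id)
    then obtain b where "ord y = 2 ^ b"
      using divides_primepow_nat two_is_prime_nat by metis
    with max y have "ord y dvd 2 ^ a"
      by (metis P_def le_imp_power_dvd)
    then have "g [^] ((2 * d + 1) * 2 ^ (a - 1)) = \<one>"
      using pow[of "a - 1"] a y by (metis pow_eq_id)
    then have "2 ^ Suc (a - 1) dvd (2 * d + 1) * 2 ^ (a - 1)"
      using g a by (metis int_pow_eq_id of_nat_numeral of_nat_power)
    then show False by simp
  qed
  with g(1) that show ?thesis by blast
qed

text \<open>Applying the map twice is conjugation by \<open>g\<close>: (s^-1 g)^-1 g = g^-1 s
  g.\<close>

lemma funpow_inv_mult:
  assumes [simp]: "g \<in> carrier G" "s \<in> carrier G"
  shows "((\<lambda>x. inv x \<otimes> g) ^^ (2 * n)) s = g [^] (- int n) \<otimes> s \<otimes> g [^] int n"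
proof (induction n)
  case (Suc n)
  let ?h = "g [^] int n"
  have h: "g [^] (1 + int n) = ?h \<otimes> g" "g [^] (- 1 - int n) = inv g \<otimes> inv ?h"
    using int_pow_mult[of g "int n" 1] int_pow_mult[of g "-1" "- int n"]
    by (simp_all add: add.commute int_pow_neg)
  show ?case
    using Suc by (simp add: h int_pow_neg inv_mult_group m_assoc)
qed simp

text \<open>Coinciding iterates of opposite parity say that a conjugate of \<open>s\<close> by a
  power of \<open>g\<close> equals a conjugate of s^-1 by a power of \<open>g\<close>, times
  \<open>g\<close>. This relation turns into a square root of an odd power of
  \<open>g\<close>.\<close>

lemma funpow_inv_mult_parity:
  assumes g: "g \<in> carrier G" and s: "s \<in> carrier G"
    and nonsq: "\<And>y d. y \<in> carrier G \<Longrightarrow> y \<otimes> y \<noteq> g [^] (2 * d + 1 :: int)"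
    and eq: "((\<lambda>x. inv x \<otimes> g) ^^ m) s = ((\<lambda>x. inv x \<otimes> g) ^^ n) s"
  shows "even (m + n)"
proof -
  let ?f = "\<lambda>x. inv x \<otimes> g"
  have no: False if "(?f ^^ (2 * i)) s = (?f ^^ Suc (2 * j)) s" for i j
  proof -
    define u v where "u = g [^] int i" and "v = g [^] int j"
    have [simp]: "u \<in> carrier G" "v \<in> carrier G" "g \<in> carrier G" "s \<in> carrier G"
      using g s by (auto simp: u_def v_def)
    have "inv u \<otimes> s \<otimes> u = inv (inv v \<otimes> s \<otimes> v) \<otimes> g"
      using that by (simp add: funpow_inv_mult int_pow_neg u_def v_def)
    then have AB: "inv u \<otimes> s \<otimes> u = inv v \<otimes> inv s \<otimes> v \<otimes> g"
      by (simp add: m_assoc inv_mult_group)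
    \<comment> \<open>Here \<open>c\<close> is g^(j-i). Inserting \<open>AB\<close> into (s c)^2
      cancels both occurrences of \<open>s\<close> and leaves only powers of \<open>g\<close>, with
      total exponent 2(j-i)+1.\<close>
    define c where "c = v \<otimes> inv u"
    have cancel: "x \<otimes> (inv x \<otimes> z) = z" "inv x \<otimes> (x \<otimes> z) = z"
      if "x \<in> carrier G" "z \<in> carrier G" for x z
      using that by (simp_all flip: m_assoc)
    have "(s \<otimes> c) \<otimes> (s \<otimes> c) = s \<otimes> v \<otimes> (inv u \<otimes> s \<otimes> u) \<otimes> inv u \<otimes> c"
      by (simp add: c_def m_assoc cancel)
    also have "\<dots> = v \<otimes> g \<otimes> inv u \<otimes> v \<otimes> inv u"
      unfolding AB by (simp add: c_def m_assoc cancel)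
    also have "\<dots> = g [^] (int j + 1 - int i + int j - int i)"
      using g by (simp only: u_def v_def int_pow_mult int_pow_diff int_pow_1 int_pow_closed)
    also have "int j + 1 - int i + int j - int i = 2 * (int j - int i) + 1"
      by simp
    finally show False
      using nonsq[of "s \<otimes> c" "int j - int i"] by (simp add: c_def)
  qed
  show ?thesis
  proof (rule ccontr)
    assume "odd (m + n)"
    then consider i j where "m = 2 * i" "n = Suc (2 * j)" | i j where "n = 2 * i" "m = Suc (2 * j)"
      by (metis even_add evenE oddE Suc_eq_plus1)
    then show False using no eq by cases metis+
  qed
qed

end

theorem theorem4p4:
  fixes G :: "('a, 'b) monoid_scheme" and k :: nat
  assumes "group G"
    and "finite (carrier G)"
    and "order G = 2 * k"
  shows "\<exists>S. S \<subseteq> carrier G \<and> card S = k \<and> S <#>\<^bsub>G\<^esub> S \<noteq> carrier G"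
proof -
  interpret group G by fact
  obtain g where g: "g \<in> carrier G"
    and nonsq: "\<And>y d. y \<in> carrier G \<Longrightarrow> y \<otimes>\<^bsub>G\<^esub> y \<noteq> g [^]\<^bsub>G\<^esub> (2 * d + 1 :: int)"
    using ex_odd_powers_nonsquare assms(2,3) by (metis dvd_triv_left)
  let ?f = "\<lambda>x. inv\<^bsub>G\<^esub> x \<otimes>\<^bsub>G\<^esub> g"
  have f_closed: "?f x \<in> carrier G" if "x \<in> carrier G" for x
    using that g by simp
  have "inj_on ?f (carrier G)"
    using g by (intro inj_onI) (metis inv_closed inv_inv right_cancel)
  then have bij: "bij_betw ?f (carrier G) (carrier G)"
    using assms(2) f_closed by (simp add: bij_betw_def endo_inj_surj image_subset_iff)
  \<comment> \<open>The carrier is closed under the map, so the alternation holds at every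
    element.\<close>
  obtain S where S: "S \<subseteq> carrier G"
    and alt: "\<And>x. x \<in> carrier G \<Longrightarrow> ?f x \<in> S \<longleftrightarrow> x \<notin> S"
    using ex_alternating_set[of "carrier G" ?f] funpow_inv_mult_parity[OF g _ nonsq] f_closed
    by metis
  have "card S = k"
    using card_alternating_set[OF assms(2) bij S alt] assms(3) by (simp add: order_def)
  moreover have "g \<notin> S <#>\<^bsub>G\<^esub> S"
  proof
    assume "g \<in> S <#>\<^bsub>G\<^esub> S"
    then obtain s t where st: "s \<in> S" "t \<in> S" "g = s \<otimes>\<^bsub>G\<^esub> t"
      by (auto simp: set_mult_def)
    then have "?f s = t" using S by (auto simp: inv_solve_left' subset_iff)
    moreover have "s \<in> carrier G" using S st(1) by blast
    ultimately show False using alt[of s] st(1,2) by simp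
  qed
  ultimately show ?thesis using S g by blast
qed

end
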